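(* Let $n_o,n_m,p\ge 1$, let $\mathbf{X}_o\in\mathbb{R}^{n_o\times p}$ with $\mathbf{X}_o^T\mathbf{X}_o$ invertible, $\mathbf{X}_m\in\mathbb{R}^{n_m\times p}$ and $\mathbf{Y}_o\in\mathbb{R}^{n_o}$, where missing values occur only in the response variable. Then the iterative solution to the EM algorithm produces the regression coefficients calculated with only the complete data: if $\mathbf{b}\in\mathbb{R}^p$ is the vector of regression coefficients that the EM iteration described in the context converges upon, then $$\mathbf{b}=\mathbf{b}_o:=(\mathbf{X}_o^T\mathbf{X}_o)^{-1}\mathbf{X}_o^T\mathbf{Y}_o .$$
   Context: A response variable has $n=n_o+n_m$ entries, of which $n_o$ are observed (vector $\mathbf{Y}_o$) and $n_m$ are missing; $\mathbf{X}_o$ and $\mathbf{X}_m$ are the (fully known) covariate matrices, possibly including an intercept column of ones, for the observations with observed and missing response, respectively. Put $\mathbf{X}=\begin{pmatrix}\mathbf{X}_o\\ \mathbf{X}_m\end{pmatrix}$. The EM iteration is: start from some $\mathbf{b}^{(0)}\in\mathbb{R}^p$; given $\mathbf{b}^{(\tau)}$, impute the missing responses by $\hat{\mathbf{Y}}_m^{(\tau)}=\mathbf{X}_m\mathbf{b}^{(\tau)}$, and let $\mathbf{b}^{(\tau+1)}$ be the ordinary least squares coefficients of the completed response on $\mathbf{X}$, i.e. $$\mathbf{b}^{(\tau+1)}=(\mathbf{X}^T\mathbf{X})^{-1}\mathbf{X}^T\begin{pmatrix}\mathbf{Y}_o\\ \mathbf{X}_m\mathbf{b}^{(\tau)}\end{pmatrix};$$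 repeat until convergence. A vector $\mathbf{b}$ converged upon satisfies $\mathbf{b}=(\mathbf{X}^T\mathbf{X})^{-1}\mathbf{X}^T\begin{pmatrix}\mathbf{Y}_o\\ \mathbf{X}_m\mathbf{b}\end{pmatrix}$. That the iteration converges is presupposed, not part of the claim. *)

theory Defs
  imports "HOL-Analysis.Analysis"
begin

(* Vertical block (upper over lower). With 'a = real this concatenates response
   vectors; with 'a = real ^ 'p it stacks matrices, whose entries are their rows. *)
definition stack :: "'a ^ 'o \<Rightarrow> 'a ^ 'm \<Rightarrow> 'a ^ ('o + 'm)" where
  "stack U L = (\<chi> i. case i of Inl j \<Rightarrow> U $ j | Inr k \<Rightarrow> L $ k)"

(* (X^T X)^{-1} X^T Y; meaningful only when X^T X is invertible, since
   matrix_inv is unspecified otherwise. *)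
definition ols :: "real ^ 'p ^ 'n \<Rightarrow> real ^ 'n \<Rightarrow> real ^ 'p" where
  "ols X Y = (matrix_inv (transpose X ** X) ** transpose X) *v Y"

definition impute :: "real ^ 'p ^ 'm \<Rightarrow> real ^ 'p \<Rightarrow> real ^ 'm" where
  "impute Xm b = Xm *v b"

definition em_step ::
  "real ^ 'p ^ 'o \<Rightarrow> real ^ 'p ^ 'm \<Rightarrow> real ^ 'o \<Rightarrow> real ^ 'p \<Rightarrow> real ^ 'p" where
  "em_step Xo Xm Yo b = ols (stack Xo Xm) (stack Yo (impute Xm b))"

primrec em_iterate ::
  "real ^ 'p ^ 'o \<Rightarrow> real ^ 'p ^ 'm \<Rightarrow> real ^ 'o \<Rightarrow> real ^ 'p \<Rightarrow> nat \<Rightarrow> real ^ 'p" where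
  "em_iterate Xo Xm Yo b0 0 = b0"
| "em_iterate Xo Xm Yo b0 (Suc t) = em_step Xo Xm Yo (em_iterate Xo Xm Yo b0 t)"

end

theory Submission
  imports Defs
begin

text \<open>
  By continuity, the limit \<open>b\<close> is a fixed point of the EM step. Multiplying the fixed-point
  equation by \<open>X\<^sup>T X = Xo\<^sup>T Xo + Xm\<^sup>T Xm\<close> gives
  \<open>Xo\<^sup>T Xo b + Xm\<^sup>T Xm b = Xo\<^sup>T Yo + Xm\<^sup>T Xm b\<close>; the imputed terms cancel, leaving the normal
  equation of the complete data.
\<close>

text \<open>\<open>matrix_inv\<close> is a Hilbert choice of a two-sided inverse, so invertibility
  supplies the witness that gives the choice its defining property.\<close>

lemma matrix_inv_mult_left:
  fixes A :: "'a::semiring_1 ^ 'n ^ 'm"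
  assumes "invertible A"
  shows "matrix_inv A ** A = mat 1"
  using someI_ex[OF assms[unfolded invertible_def]] unfolding matrix_inv_def by blast

lemma matrix_inv_mult_right:
  fixes A :: "'a::semiring_1 ^ 'n ^ 'm"
  assumes "invertible A"
  shows "A ** matrix_inv A = mat 1"
  using someI_ex[OF assms[unfolded invertible_def]] unfolding matrix_inv_def by blast

text \<open>Trades the explicit inverse for the normal equation. The equivalence is read forwards
  for the completed data and backwards for the complete cases.\<close>

lemma ols_unique:
  fixes X :: "real ^ 'p ^ 'n"
  assumes inv: "invertible (transpose X ** X)"
  shows "b = ols X Y \<longleftrightarrow> transpose X *v (X *v b) = transpose X *v Y"
proof
  assume "b = ols X Y"
  then show "transpose X *v (X *v b) = transpose X *v Y"
    using matrix_inv_mult_right[OF inv]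
    by (simp add: ols_def matrix_vector_mul_assoc matrix_mul_assoc)
next
  assume "transpose X *v (X *v b) = transpose X *v Y"
  then have "matrix_inv (transpose X ** X) *v ((transpose X ** X) *v b) = ols X Y"
    by (simp add: ols_def flip: matrix_vector_mul_assoc)
  then show "b = ols X Y"
    using matrix_inv_mult_left[OF inv] by (simp add: matrix_vector_mul_assoc)
qed

lemma stack_matrix_vector_mult:
  fixes U :: "real ^ 'p ^ 'o" and L :: "real ^ 'p ^ 'm"
  shows "stack U L *v v = stack (U *v v) (L *v v)"
  by (simp add: vec_eq_iff stack_def matrix_vector_mult_def split: sum.split)

lemma sum_UNIV_Plus:
  fixes f :: "'o::finite + 'm::finite \<Rightarrow> 'a::comm_monoid_add"
  shows "sum f UNIV = (\<Sum>j\<in>UNIV. f (Inl j)) + (\<Sum>k\<in>UNIV. f (Inr k))"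
  using sum.Plus[of "UNIV :: 'o set" "UNIV :: 'm set" f] by (simp add: o_def)

lemma transpose_stack_vector_mult:
  fixes U :: "real ^ 'p ^ 'o" and L :: "real ^ 'p ^ 'm"
  shows "transpose (stack U L) *v stack y z = transpose U *v y + transpose L *v z"
  by (simp add: vec_eq_iff stack_def matrix_vector_mult_def transpose_def
      sum_UNIV_Plus)

lemma inner_gram:
  fixes X :: "real ^ 'p ^ 'n"
  shows "v \<bullet> (transpose X *v (X *v v)) = (norm (X *v v))\<^sup>2"
  by (simp add: inner_commute[of v] dot_lmul_matrix power2_norm_eq_inner)

text \<open>Stacking adds the Gram matrices of \<open>Xo\<close> and \<open>Xm\<close>. Both are
  positive semidefinite, so the sum inherits a trivial kernel from the first.\<close>

lemma invertible_gram_stack: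
  fixes Xo :: "real ^ 'p ^ 'o" and Xm :: "real ^ 'p ^ 'm"
  assumes "invertible (transpose Xo ** Xo)"
  shows "invertible (transpose (stack Xo Xm) ** stack Xo Xm)"
proof -
  \<comment> \<open>For a square matrix a trivial kernel gives a left inverse, hence
    invertibility.\<close>
  have "v = 0" if "(transpose (stack Xo Xm) ** stack Xo Xm) *v v = 0" for v
  proof -
    have "transpose Xo *v (Xo *v v) + transpose Xm *v (Xm *v v) = 0"
      using that
      unfolding matrix_vector_mul_assoc[symmetric] stack_matrix_vector_mult
        transpose_stack_vector_mult .
    \<comment> \<open>Take the inner product with \<open>v\<close>; by \<open>inner_gram\<close>
      each summand becomes a squared norm.\<close>
    then have "(norm (Xo *v v))\<^sup>2 + (norm (Xm *v v))\<^sup>2 = 0"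
      by (metis inner_add_right inner_gram inner_zero_right)
    then have "Xo *v v = 0"
      by (simp add: add_nonneg_eq_0_iff)
    then have "(transpose Xo ** Xo) *v v = 0"
      by (simp flip: matrix_vector_mul_assoc)
    then show "v = 0"
      using assms unfolding invertible_left_inverse matrix_left_invertible_ker by blast
  qed
  then show ?thesis
    unfolding invertible_left_inverse matrix_left_invertible_ker by blast
qed

lemma tendsto_matrix_vector_mult:
  fixes A :: "real ^ 'n ^ 'm"
  assumes "(f \<longlongrightarrow> v) F"
  shows "((\<lambda>x. A *v f x) \<longlongrightarrow> A *v v) F"
  using assms by (rule bounded_linear.tendsto[OF matrix_vector_mul_bounded_linear])

text \<open>The step is affine in the current coefficients: a fixed matrix applied to a constant
  vector plus a linear image of \<open>b\<close>.\<close>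

lemma tendsto_em_step:
  assumes "(f \<longlongrightarrow> b) F"
  shows "((\<lambda>x. em_step Xo Xm Yo (f x)) \<longlongrightarrow> em_step Xo Xm Yo b) F"
  unfolding em_step_def ols_def impute_def
    matrix_vector_mul_assoc[symmetric] transpose_stack_vector_mult
  by (intro tendsto_matrix_vector_mult tendsto_add tendsto_const assms)

lemma em_iterate_limit_fixed_point:
  assumes "em_iterate Xo Xm Yo b0 \<longlonglongrightarrow> b"
  shows "em_step Xo Xm Yo b = b"
\<comment> \<open>The shifted sequence of iterates has two limits: one by continuity of the step,
  the other as a tail of the original sequence.\<close>
proof (rule LIMSEQ_unique)
  show "(\<lambda>t. em_iterate Xo Xm Yo b0 (Suc t)) \<longlonglongrightarrow> em_step Xo Xm Yo b"
    using tendsto_em_step[OF assms] by simp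
  show "(\<lambda>t. em_iterate Xo Xm Yo b0 (Suc t)) \<longlonglongrightarrow> b"
    using assms by (rule LIMSEQ_Suc)
qed

theorem theorem3:
  fixes Xo :: "real ^ 'p ^ 'o"
    and Xm :: "real ^ 'p ^ 'm"
    and Yo :: "real ^ 'o"
    and b0 b :: "real ^ 'p"
  assumes "invertible (transpose Xo ** Xo)"
    and "em_iterate Xo Xm Yo b0 \<longlonglongrightarrow> b"
  shows "b = ols Xo Yo"
proof -
  have "b = ols (stack Xo Xm) (stack Yo (Xm *v b))"
    using em_iterate_limit_fixed_point[OF assms(2)] by (simp add: em_step_def impute_def)
  then have "transpose Xo *v (Xo *v b) + transpose Xm *v (Xm *v b)
      = transpose Xo *v Yo + transpose Xm *v (Xm *v b)"
    unfolding ols_unique[OF invertible_gram_stack[OF assms(1)]]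
      stack_matrix_vector_mult transpose_stack_vector_mult .
  then show ?thesis
    using ols_unique[OF assms(1)] by simp
qed

end
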